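(* For every integer $s$: for every non-negative integer $n$, \[ 2\sum_{k = 0}^n \binom{2n}{2k} \frac{F_{6k + s}}{5^k} =\left(\frac{4}{5}\right)^{n}\bigl(4^{n} F_{2n + s} + F_s\bigr),\qquad 2\sum_{k = 0}^n \binom{2n}{2k} \frac{L_{6k + s}}{5^k} = \left(\frac{4}{5}\right)^{n} \bigl( 4^n L_{2n + s} + L_s\bigr), \] and for every positive integer $n$, \[ 8\sum_{k = 0}^n \binom{2n - 1}{2k}\frac{F_{6k + s}}{5^k} = \left(\frac{4}{5}\right)^{n} \bigl(4^{n} L_{2n - 1 + s} -2 L_s\bigr),\qquad 2\sum_{k = 0}^n \binom{2n - 1}{2k}\frac{ L_{6k + s}}{5^k} =\left(\frac{4}{5}\right)^{n-1} \bigl(4^{n}F_{2n - 1 + s} - 2F_s\bigr), \] where $\binom{2n-1}{2n}=0$.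
   Context: The Fibonacci numbers $F_j$ and Lucas numbers $L_j$ are defined for all integers $j$ by $F_0=0$, $F_1=1$, $L_0=2$, $L_1=1$, $F_j=F_{j-1}+F_{j-2}$, $L_j=L_{j-1}+L_{j-2}$, with $F_{-j}=(-1)^{j-1}F_j$ and $L_{-j}=(-1)^jL_j$. *)

theory Defs
  imports Complex_Main "HOL-Number_Theory.Fib"
begin

definition fib_int :: "int \<Rightarrow> int" where
  "fib_int j = (if j \<ge> 0 then int (fib (nat j))
                else (- 1) ^ (nat (- j) - 1) * int (fib (nat (- j))))"

fun lucas :: "nat \<Rightarrow> nat" where
  "lucas 0 = 2"
| "lucas (Suc 0) = 1"
| "lucas (Suc (Suc n)) = lucas (Suc n) + lucas n"

definition lucas_int :: "int \<Rightarrow> int" where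
  "lucas_int j = (if j \<ge> 0 then int (lucas (nat j))
                  else (- 1) ^ nat (- j) * int (lucas (nat (- j))))"

lemma fib_int_0 [simp]: "fib_int 0 = 0"
  and fib_int_1 [simp]: "fib_int 1 = 1"
  and lucas_int_0 [simp]: "lucas_int 0 = 2"
  and lucas_int_1 [simp]: "lucas_int 1 = 1"
  by (simp_all add: fib_int_def lucas_int_def)

lemma int_index_cases:
  fixes j :: int
  obtains (nonneg) m where "j = int m + 2" | (one) "j = 1" | (zero) "j = 0"
    | (neg) m where "j = - int m - 1"
proof -
  consider "j \<ge> 2" | "j = 1" | "j = 0" | "j \<le> - 1" by linarith
  then show ?thesis
  proof cases
    case 1
    then have "j = int (nat (j - 2)) + 2" by simp
    then show ?thesis by (rule that(1))
  next
    case 4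
    then have "j = - int (nat (- j - 1)) - 1" by simp
    then show ?thesis by (rule that(4))
  qed (use that in blast)+
qed

lemma fib_int_rec: "fib_int j = fib_int (j - 1) + fib_int (j - 2)"
proof (cases j rule: int_index_cases)
  case (nonneg m)
  then have "nat j = Suc (Suc m)" "nat (j - 1) = Suc m" "nat (j - 2) = m" by auto
  with nonneg show ?thesis by (simp add: fib_int_def)
next
  case (neg m)
  then have "nat (- j) = Suc m" "nat (- (j - 1)) = Suc (Suc m)"
    "nat (- (j - 2)) = Suc (Suc (Suc m))" by auto
  with neg show ?thesis by (simp add: fib_int_def algebra_simps)
qed (simp_all add: fib_int_def numeral_eq_Suc)

lemma lucas_int_rec: "lucas_int j = lucas_int (j - 1) + lucas_int (j - 2)"
proof (cases j rule: int_index_cases)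
  case (nonneg m)
  then have "nat j = Suc (Suc m)" "nat (j - 1) = Suc m" "nat (j - 2) = m" by auto
  with nonneg show ?thesis by (simp add: lucas_int_def)
next
  case (neg m)
  then have "nat (- j) = Suc m" "nat (- (j - 1)) = Suc (Suc m)"
    "nat (- (j - 2)) = Suc (Suc (Suc m))" by auto
  with neg show ?thesis by (simp add: lucas_int_def algebra_simps)
qed (simp_all add: lucas_int_def numeral_eq_Suc)

end

theory Submission imports Defs
begin

text \<open>
  By Binet's formulas every identity is a linear combination of two binomial sums over even
  indices, with \<open>x = \<phi>\<^sup>3 / \<surd>5\<close> and \<open>x = \<psi>\<^sup>3 / \<surd>5\<close>. They have closed forms because
  \<open>1 + \<phi>\<^sup>3 / \<surd>5 = 4 \<phi> / \<surd>5\<close> and \<open>1 - \<phi>\<^sup>3 / \<surd>5 = - 2 / \<surd>5\<close>, while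
  \<open>1 + \<psi>\<^sup>3 / \<surd>5 = 2 / \<surd>5\<close> and \<open>1 - \<psi>\<^sup>3 / \<surd>5 = - 4 \<psi> / \<surd>5\<close>.
\<close>

definition phi :: real where "phi = (1 + sqrt 5) / 2"
definition psi :: real where "psi = (1 - sqrt 5) / 2"

lemma phi_square: "phi\<^sup>2 = phi + 1"
  and psi_square: "psi\<^sup>2 = psi + 1"
  by (simp_all add: phi_def psi_def power2_eq_square field_simps)

lemma phi_neq_0: "phi \<noteq> 0"
  and psi_neq_0: "psi \<noteq> 0"
  using phi_square psi_square by auto

text \<open>The recurrence determines each value from its two neighbours on either side, so two
  consecutive values fix the whole sequence on the integers. This gives Binet's formulas at negative
  indices without any case split on signs.\<close>

lemma fibonacci_recurrence_unique:
  fixes f g :: "int \<Rightarrow> real"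
  assumes f: "\<And>j. f j = f (j - 1) + f (j - 2)"
    and g: "\<And>j. g j = g (j - 1) + g (j - 2)"
    and "f 0 = g 0" "f 1 = g 1"
  shows "f j = g j"
proof -
  \<comment> \<open>Agreement at a pair of consecutive indices is what can be shifted one place up
    or down.\<close>
  have "f j = g j \<and> f (j + 1) = g (j + 1)"
  proof (induction j rule: int_induct[where k = 0])
    case base
    then show ?case using assms(3,4) by simp
  next
    case (step1 i)
    then show ?case using f[of "i + 2"] g[of "i + 2"] by (simp add: algebra_simps)
  next
    case (step2 i)
    then show ?case using f[of "i + 1"] g[of "i + 1"] by (simp add: algebra_simps)
  qed
  then show ?thesis ..
qed

lemma powi_fibonacci_recurrence:
  fixes x :: real
  assumes "x\<^sup>2 = x + 1"
  shows "x powi j = x powi (j - 1) + x powi (j - 2)"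
proof -
  have x: "x \<noteq> 0" using assms by auto
  have "x powi j = x powi (j - 2) * x\<^sup>2"
    using power_int_add[of x "j - 2" 2] x by simp
  also have "\<dots> = x powi (j - 2) * x + x powi (j - 2)"
    by (simp add: assms algebra_simps)
  also have "x powi (j - 2) * x = x powi (j - 1)"
    using power_int_add[of x "j - 2" 1] x by simp
  finally show ?thesis .
qed

lemma fib_int_binet: "real_of_int (fib_int j) = (phi powi j - psi powi j) / sqrt 5"
proof (rule fibonacci_recurrence_unique)
  fix j
  show "real_of_int (fib_int j) = real_of_int (fib_int (j - 1)) + real_of_int (fib_int (j - 2))"
    by (subst fib_int_rec) simp
  show "(phi powi j - psi powi j) / sqrt 5 = (phi powi (j - 1) - psi powi (j - 1)) / sqrt 5
      + (phi powi (j - 2) - psi powi (j - 2)) / sqrt 5"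
    by (simp add: powi_fibonacci_recurrence[OF phi_square, of j]
        powi_fibonacci_recurrence[OF psi_square, of j] flip: add_divide_distrib)
qed (simp_all add: phi_def psi_def field_simps)

lemma lucas_int_binet: "real_of_int (lucas_int j) = phi powi j + psi powi j"
proof (rule fibonacci_recurrence_unique)
  fix j
  show "real_of_int (lucas_int j) = real_of_int (lucas_int (j - 1)) + real_of_int (lucas_int (j - 2))"
    by (subst lucas_int_rec) simp
  show "phi powi j + psi powi j = phi powi (j - 1) + psi powi (j - 1)
      + (phi powi (j - 2) + psi powi (j - 2))"
    by (simp add: powi_fibonacci_recurrence[OF phi_square, of j]
        powi_fibonacci_recurrence[OF psi_square, of j])
qed (simp_all add: phi_def psi_def field_simps)

lemma sum_split_parity:
  fixes g :: "nat \<Rightarrow> 'a::comm_monoid_add"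
  shows "(\<Sum>j\<le>2 * n + 1. g j) = (\<Sum>k=0..n. g (2 * k) + g (2 * k + 1))"
  by (induction n) (simp_all add: add.assoc)

text \<open>In the sum of the expansions of \<open>(1 + x) ^ m\<close> and
  \<open>(1 - x) ^ m\<close> the odd powers cancel and the even ones double. The bound on
  \<open>m\<close> ensures that no even index up to \<open>m\<close> is missed; it admits both
  \<open>2 * n\<close> and \<open>2 * n - 1\<close>.\<close>

lemma sum_choose_even:
  fixes x :: "'a::comm_ring_1"
  assumes "m \<le> 2 * n + 1"
  shows "2 * (\<Sum>k=0..n. of_nat (m choose (2 * k)) * x ^ (2 * k)) = (1 + x) ^ m + (1 - x) ^ m"
proof -
  have binom: "(1 + y) ^ m = (\<Sum>j\<le>2 * n + 1. of_nat (m choose j) * y ^ j)" for y :: 'a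
  proof -
    have "(1 + y) ^ m = (\<Sum>j\<le>m. of_nat (m choose j) * y ^ j)"
      using binomial_ring[of y 1 m] by (simp add: add.commute)
    \<comment> \<open>Padding with vanishing binomials makes the range end at an odd index, so that
      it splits into pairs \<open>2 * k\<close>, \<open>2 * k + 1\<close>.\<close>
    also have "\<dots> = (\<Sum>j\<le>2 * n + 1. of_nat (m choose j) * y ^ j)"
      using assms by (intro sum.mono_neutral_left) (auto simp: binomial_eq_0)
    finally show ?thesis .
  qed
  have "(1 + x) ^ m + (1 - x) ^ m =
      (\<Sum>j\<le>2 * n + 1. of_nat (m choose j) * x ^ j + of_nat (m choose j) * (- x) ^ j)"
    using binom[of x] binom[of "- x"] by (simp only: sum.distrib diff_conv_add_uminus)
  also have "\<dots> = (\<Sum>k=0..n. of_nat (m choose (2 * k)) * x ^ (2 * k) + of_nat (m choose (2 * k)) * x ^ (2 * k))"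
    unfolding sum_split_parity by (intro sum.cong refl) simp
  also have "\<dots> = 2 * (\<Sum>k=0..n. of_nat (m choose (2 * k)) * x ^ (2 * k))"
    unfolding sum.distrib by (rule mult_2[symmetric])
  finally show ?thesis ..
qed

text \<open>Since \<open>x ^ (6 * k) / 5 ^ k\<close> is an even power of
  \<open>x ^ 3 / sqrt 5\<close>, the previous lemma applies once \<open>x powi s\<close> is factored
  out.\<close>

lemma sum_choose_even_powi:
  fixes x :: real
  assumes "m \<le> 2 * n + 1" "x \<noteq> 0"
  shows "2 * (\<Sum>k=0..n. real (m choose (2 * k)) * (x powi (6 * int k + s) / 5 ^ k))
    = x powi s * ((1 + x ^ 3 / sqrt 5) ^ m + (1 - x ^ 3 / sqrt 5) ^ m)"
proof -
  have "x powi (6 * int k + s) / 5 ^ k = x powi s * (x ^ 3 / sqrt 5) ^ (2 * k)" for k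
  proof -
    have "x powi (6 * int k + s) = x ^ (6 * k) * x powi s"
      using assms(2) power_int_of_nat[of x "6 * k"] by (simp add: power_int_add del: power_int_of_nat)
    moreover have "(x ^ 3 / sqrt 5) ^ (2 * k) = x ^ (6 * k) / 5 ^ k"
    proof -
      have "(x ^ 3 / sqrt 5)\<^sup>2 = x ^ 6 / 5"
        by (simp add: power_divide flip: power_mult)
      then show ?thesis by (simp only: power_mult power_divide)
    qed
    ultimately show ?thesis by simp
  qed
  then show ?thesis
    unfolding sum_choose_even[OF assms(1), symmetric] sum_distrib_left
    by (simp only: mult.left_commute)
qed

lemma phi_cube_sqrt5: "1 + phi ^ 3 / sqrt 5 = 4 * phi / sqrt 5" "1 - phi ^ 3 / sqrt 5 = - 2 / sqrt 5"
  and psi_cube_sqrt5: "1 + psi ^ 3 / sqrt 5 = 2 / sqrt 5" "1 - psi ^ 3 / sqrt 5 = - 4 * psi / sqrt 5"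
proof -
  \<comment> \<open>Multiply the quadratic equation by \<open>x\<close> and reduce once
    more.\<close>
  have "x ^ 3 = 2 * x + 1" if "x\<^sup>2 = x + 1" for x :: real
    using that by (simp add: power3_eq_cube power2_eq_square algebra_simps)
  then have "phi ^ 3 = 2 + sqrt 5" "psi ^ 3 = 2 - sqrt 5"
    using phi_square psi_square by (simp_all add: phi_def psi_def)
  then show "1 + phi ^ 3 / sqrt 5 = 4 * phi / sqrt 5" "1 - phi ^ 3 / sqrt 5 = - 2 / sqrt 5"
    "1 + psi ^ 3 / sqrt 5 = 2 / sqrt 5" "1 - psi ^ 3 / sqrt 5 = - 4 * psi / sqrt 5"
    by (simp_all add: phi_def psi_def add_divide_distrib diff_divide_distrib)
qed

lemma phi_sum:
  assumes "m \<le> 2 * n + 1"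
  shows "2 * (\<Sum>k=0..n. real (m choose (2 * k)) * (phi powi (6 * int k + s) / 5 ^ k))
    = (4 ^ m * phi powi (int m + s) + (- 2) ^ m * phi powi s) / sqrt 5 ^ m"
  unfolding sum_choose_even_powi[OF assms phi_neq_0] phi_cube_sqrt5 power_divide power_mult_distrib
  by (simp add: power_int_add phi_neq_0 add_divide_distrib algebra_simps)

text \<open>Compared with \<open>phi_sum\<close>, both terms of the numerator carry an extra factor
  \<open>(- 1) ^ m\<close>. Its sign decides whether combining the two sums keeps Fibonacci and
  Lucas numbers or exchanges them.\<close>

lemma psi_sum:
  assumes "m \<le> 2 * n + 1"
  shows "2 * (\<Sum>k=0..n. real (m choose (2 * k)) * (psi powi (6 * int k + s) / 5 ^ k))
    = ((- 4) ^ m * psi powi (int m + s) + 2 ^ m * psi powi s) / sqrt 5 ^ m"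
  unfolding sum_choose_even_powi[OF assms psi_neq_0] psi_cube_sqrt5 power_divide power_mult_distrib
  by (simp add: power_int_add psi_neq_0 add_divide_distrib algebra_simps)

lemma fib_int_sum:
  "(\<Sum>k=0..n. real (m choose (2 * k)) * (real_of_int (fib_int (6 * int k + s)) / 5 ^ k))
    = ((\<Sum>k=0..n. real (m choose (2 * k)) * (phi powi (6 * int k + s) / 5 ^ k))
      - (\<Sum>k=0..n. real (m choose (2 * k)) * (psi powi (6 * int k + s) / 5 ^ k))) / sqrt 5"
  unfolding sum_subtractf[symmetric] sum_divide_distrib
  by (intro sum.cong refl) (simp add: fib_int_binet field_simps)

lemma lucas_int_sum:
  "(\<Sum>k=0..n. real (m choose (2 * k)) * (real_of_int (lucas_int (6 * int k + s)) / 5 ^ k))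
    = (\<Sum>k=0..n. real (m choose (2 * k)) * (phi powi (6 * int k + s) / 5 ^ k))
      + (\<Sum>k=0..n. real (m choose (2 * k)) * (psi powi (6 * int k + s) / 5 ^ k))"
  unfolding sum.distrib[symmetric]
  by (intro sum.cong refl) (simp add: lucas_int_binet field_simps)

theorem theorem10:
  fixes s :: int
  shows
    "(\<forall>n::nat.
        2 * (\<Sum>k=0..n. real ((2 * n) choose (2 * k)) * (real_of_int (fib_int (6 * int k + s)) / 5 ^ k))
          = (4 / 5) ^ n * (4 ^ n * real_of_int (fib_int (2 * int n + s)) + real_of_int (fib_int s))
      \<and> 2 * (\<Sum>k=0..n. real ((2 * n) choose (2 * k)) * (real_of_int (lucas_int (6 * int k + s)) / 5 ^ k))
          = (4 / 5) ^ n * (4 ^ n * real_of_int (lucas_int (2 * int n + s)) + real_of_int (lucas_int s)))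
   \<and> (\<forall>n::nat. n > 0 \<longrightarrow>
        8 * (\<Sum>k=0..n. real ((2 * n - 1) choose (2 * k)) * (real_of_int (fib_int (6 * int k + s)) / 5 ^ k))
          = (4 / 5) ^ n * (4 ^ n * real_of_int (lucas_int (2 * int n - 1 + s)) - 2 * real_of_int (lucas_int s))
      \<and> 2 * (\<Sum>k=0..n. real ((2 * n - 1) choose (2 * k)) * (real_of_int (lucas_int (6 * int k + s)) / 5 ^ k))
          = (4 / 5) ^ (n - 1) * (4 ^ n * real_of_int (fib_int (2 * int n - 1 + s)) - 2 * real_of_int (fib_int s)))"
proof (intro conjI allI impI)
  fix n :: nat
  \<comment> \<open>For an even exponent all signs disappear, so \<open>A\<close> and
    \<open>B\<close> have the same form in \<open>phi\<close> and \<open>psi\<close>, and each kind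
    of number is reproduced.\<close>
  have pow: "sqrt 5 ^ (2 * n) = 5 ^ n" "(4::real) ^ (2 * n) = 4 ^ n * 4 ^ n" "(- 4::real) ^ (2 * n) = 4 ^ n * 4 ^ n"
    "(2::real) ^ (2 * n) = 4 ^ n" "(- 2::real) ^ (2 * n) = 4 ^ n"
    by (simp_all add: power_mult flip: power_mult_distrib)
  define A where "A = (\<Sum>k=0..n. real ((2 * n) choose (2 * k)) * (phi powi (6 * int k + s) / 5 ^ k))"
  define B where "B = (\<Sum>k=0..n. real ((2 * n) choose (2 * k)) * (psi powi (6 * int k + s) / 5 ^ k))"
  have le: "2 * n \<le> 2 * n + 1" and idx: "int (2 * n) = 2 * int n" by simp_all
  have A: "2 * A = (4 ^ n * 4 ^ n * phi powi (2 * int n + s) + 4 ^ n * phi powi s) / 5 ^ n"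
    unfolding A_def phi_sum[OF le] pow idx by simp
  have B: "2 * B = (4 ^ n * 4 ^ n * psi powi (2 * int n + s) + 4 ^ n * psi powi s) / 5 ^ n"
    unfolding B_def psi_sum[OF le] pow idx by simp
  have "2 * ((A - B) / sqrt 5) = (2 * A - 2 * B) / sqrt 5" by simp
  also have "\<dots> = (4 / 5) ^ n * (4 ^ n * real_of_int (fib_int (2 * int n + s)) + real_of_int (fib_int s))"
    unfolding A B fib_int_binet
    by (simp add: power_divide add_divide_distrib diff_divide_distrib algebra_simps)
  finally show "2 * (\<Sum>k=0..n. real ((2 * n) choose (2 * k)) * (real_of_int (fib_int (6 * int k + s)) / 5 ^ k))
      = (4 / 5) ^ n * (4 ^ n * real_of_int (fib_int (2 * int n + s)) + real_of_int (fib_int s))"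
    unfolding fib_int_sum A_def B_def .
  have "2 * (A + B) = 2 * A + 2 * B" by simp
  also have "\<dots> = (4 / 5) ^ n * (4 ^ n * real_of_int (lucas_int (2 * int n + s)) + real_of_int (lucas_int s))"
    unfolding A B lucas_int_binet by (simp add: power_divide field_simps)
  finally show "2 * (\<Sum>k=0..n. real ((2 * n) choose (2 * k)) * (real_of_int (lucas_int (6 * int k + s)) / 5 ^ k))
      = (4 / 5) ^ n * (4 ^ n * real_of_int (lucas_int (2 * int n + s)) + real_of_int (lucas_int s))"
    unfolding lucas_int_sum A_def B_def .
next
  fix n :: nat
  assume "n > 0"
  then obtain r where n: "n = Suc r" by (cases n) auto
  define A where "A = (\<Sum>k=0..n. real ((2 * n - 1) choose (2 * k)) * (phi powi (6 * int k + s) / 5 ^ k))"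
  define B where "B = (\<Sum>k=0..n. real ((2 * n - 1) choose (2 * k)) * (psi powi (6 * int k + s) / 5 ^ k))"
  \<comment> \<open>An odd exponent leaves one \<open>sqrt 5\<close> over and gives \<open>B\<close>
    the opposite sign, so \<open>A - B\<close> yields Lucas numbers and \<open>A + B\<close>
    Fibonacci numbers.\<close>
  have pow: "sqrt 5 ^ (2 * n - 1) = 5 ^ r * sqrt 5" "(4::real) ^ (2 * n - 1) = 4 * 4 ^ r * 4 ^ r"
    "(- 4::real) ^ (2 * n - 1) = - (4 * 4 ^ r * 4 ^ r)"
    "(2::real) ^ (2 * n - 1) = 2 * 4 ^ r" "(- 2::real) ^ (2 * n - 1) = - (2 * 4 ^ r)"
    by (simp_all add: n power_mult flip: power_mult_distrib)
  have le: "2 * n - 1 \<le> 2 * n + 1" and idx: "int (2 * n - 1) = 2 * int n - 1" using n by simp_all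
  have A: "2 * A = (4 * 4 ^ r * 4 ^ r * phi powi (2 * int n - 1 + s) - 2 * 4 ^ r * phi powi s) / (5 ^ r * sqrt 5)"
    unfolding A_def phi_sum[OF le] pow idx by simp
  have B: "2 * B = - (4 * 4 ^ r * 4 ^ r * psi powi (2 * int n - 1 + s) - 2 * 4 ^ r * psi powi s) / (5 ^ r * sqrt 5)"
    unfolding B_def psi_sum[OF le] pow idx by simp
  have sqrt5: "sqrt 5 * (sqrt 5 * y) = 5 * y" for y
    by (simp flip: mult.assoc)
  \<comment> \<open>The extra 4 raises \<open>4 ^ r\<close> to \<open>4 ^ n\<close>, and the two
    factors \<open>sqrt 5\<close> in the denominator raise \<open>5 ^ r\<close> to
    \<open>5 ^ n\<close>.\<close>
  have "8 * ((A - B) / sqrt 5) = 4 * (2 * A - 2 * B) / sqrt 5" by simp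
  also have "\<dots> = (4 / 5) ^ n * (4 ^ n * real_of_int (lucas_int (2 * int n - 1 + s)) - 2 * real_of_int (lucas_int s))"
    unfolding A B lucas_int_binet by (simp add: n power_divide sqrt5 field_simps)
  finally show "8 * (\<Sum>k=0..n. real ((2 * n - 1) choose (2 * k)) * (real_of_int (fib_int (6 * int k + s)) / 5 ^ k))
      = (4 / 5) ^ n * (4 ^ n * real_of_int (lucas_int (2 * int n - 1 + s)) - 2 * real_of_int (lucas_int s))"
    unfolding fib_int_sum A_def B_def .
  have "2 * (A + B) = 2 * A + 2 * B" by simp
  \<comment> \<open>Here the leftover \<open>sqrt 5\<close> is the denominator in Binet's formula,
    so the power of 5 stays at \<open>r\<close>, that is \<open>n - 1\<close>.\<close>
  also have "\<dots> = (4 / 5) ^ (n - 1) * (4 ^ n * real_of_int (fib_int (2 * int n - 1 + s)) - 2 * real_of_int (fib_int s))"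
    unfolding A B fib_int_binet by (simp add: n power_divide sqrt5 field_simps)
  finally show "2 * (\<Sum>k=0..n. real ((2 * n - 1) choose (2 * k)) * (real_of_int (lucas_int (6 * int k + s)) / 5 ^ k))
      = (4 / 5) ^ (n - 1) * (4 ^ n * real_of_int (fib_int (2 * int n - 1 + s)) - 2 * real_of_int (fib_int s))"
    unfolding lucas_int_sum A_def B_def .
qed

end
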